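(* Fix an integer $d\ge 1$. Let $G$ be a graph on $n$ vertices which is the complement of a $c$-closed graph. Then the number of inclusion-maximal sets $S\subseteq V(G)$ such that $G[S]$ is $d$-degenerate is $O(n^{8d}\, \mathcal{D}_d(2dc))$.
   Context: Graphs are finite, simple and undirected. A graph $H$ is $c$-closed if any two non-adjacent vertices have at most $c-1$ common neighbors; $G$ is the complement of a $c$-closed graph iff for any two adjacent vertices $u,v$ of $G$ at most $c-1$ vertices of $G$ are adjacent to neither $u$ nor $v$ (excluding $u,v$). A graph is $d$-degenerate if every induced subgraph has a vertex of degree at most $d$ in that subgraph. $\mathcal{D}_d(N)$ denotes the maximum, over all graphs $H$ on $N$ vertices, of the number of inclusion-maximal sets $S\subseteq V(H)$ such that $H[S]$ is $d$-degenerate. *)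

theory Defs
  imports Complex_Main "Graph_Theory.Graph_Theory"
begin

text \<open>
  A finite simple undirected graph is a \<^const>\<open>pair_graph\<close>: an edge \<open>uv\<close> is represented by
  the two arcs \<open>(u,v)\<close> and \<open>(v,u)\<close>, so \<^const>\<open>out_degree\<close> is the degree.
\<close>

definition graph_complement :: "'a pair_pre_digraph \<Rightarrow> 'a pair_pre_digraph" where
  "graph_complement G = \<lparr> pverts = pverts G,
     parcs = {(u, v). u \<in> pverts G \<and> v \<in> pverts G \<and> u \<noteq> v \<and> (u, v) \<notin> parcs G} \<rparr>"

text \<open>``At most \<open>c - 1\<close>'' is written \<open>< c\<close> to avoid truncated subtraction.\<close>

definition c_closed :: "nat \<Rightarrow> 'a pair_pre_digraph \<Rightarrow> bool" where
  "c_closed c H \<longleftrightarrow>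
     (\<forall>u\<in>pverts H. \<forall>v\<in>pverts H. u \<noteq> v \<and> (u, v) \<notin> parcs H \<longrightarrow>
        card {w \<in> pverts H. (u, w) \<in> parcs H \<and> (v, w) \<in> parcs H} < c)"

definition degenerate :: "nat \<Rightarrow> ('a, 'b) pre_digraph \<Rightarrow> bool" where
  "degenerate d G \<longleftrightarrow>
     (\<forall>S \<subseteq> verts G. S \<noteq> {} \<longrightarrow> (\<exists>v\<in>S. out_degree (G \<restriction> S) v \<le> d))"

definition maximal_degenerate_sets :: "nat \<Rightarrow> 'a pair_pre_digraph \<Rightarrow> 'a set set" where
  "maximal_degenerate_sets d G =
     {S. S \<subseteq> pverts G \<and> degenerate d (with_proj G \<restriction> S) \<and>
         (\<forall>T \<subseteq> pverts G. S \<subset> T \<longrightarrow> \<not> degenerate d (with_proj G \<restriction> T))}"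

text \<open>
  Every finite graph is isomorphic to one with vertices in \<^typ>\<open>nat\<close>, so the maximum over all
  graphs on \<open>N\<close> vertices is taken over these.
\<close>

definition max_num_degenerate :: "nat \<Rightarrow> nat \<Rightarrow> nat" where
  "max_num_degenerate d N =
     Max {card (maximal_degenerate_sets d H) | H :: nat pair_pre_digraph.
            pair_graph H \<and> card (pverts H) = N}"

lemma pair_graph_iff:
  "pair_graph G \<longleftrightarrow> finite (pverts G) \<and> parcs G \<subseteq> pverts G \<times> pverts G \<and>
     sym (parcs G) \<and> irrefl (parcs G)"
proof
  assume "pair_graph G"
  then interpret pair_graph G .
  show "finite (pverts G) \<and> parcs G \<subseteq> pverts G \<times> pverts G \<and>
     sym (parcs G) \<and> irrefl (parcs G)"
    using pair_finite_verts pair_sym_arcs pair_no_loops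
    by (auto simp: symmetric_def irrefl_def dest: in_arcsD1 in_arcsD2) fastforce
next
  assume A: "finite (pverts G) \<and> parcs G \<subseteq> pverts G \<times> pverts G \<and>
     sym (parcs G) \<and> irrefl (parcs G)"
  then have "finite (parcs G)" by (meson finite_SigmaI finite_subset)
  then show "pair_graph G"
    using A by unfold_locales (auto simp: symmetric_def irrefl_def)
qed

lemma pair_graph_complement: "pair_graph G \<Longrightarrow> pair_graph (graph_complement G)"
  by (auto simp: pair_graph_iff graph_complement_def sym_def irrefl_def)

lemma complement_complement: "pair_graph G \<Longrightarrow> graph_complement (graph_complement G) = G"
  by (cases G) (auto simp: pair_graph_iff graph_complement_def irrefl_def)

lemma complement_c_closed_iff:
  assumes "pair_graph G"
  shows "(\<exists>H. pair_graph H \<and> c_closed c H \<and> G = graph_complement H) \<longleftrightarrow>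
    (\<forall>(u, v) \<in> parcs G.
       card {w \<in> pverts G - {u, v}. (u, w) \<notin> parcs G \<and> (v, w) \<notin> parcs G} < c)"
proof -
  have "(\<exists>H. pair_graph H \<and> c_closed c H \<and> G = graph_complement H) \<longleftrightarrow>
      c_closed c (graph_complement G)"
    using assms by (metis pair_graph_complement complement_complement)
  also have "\<dots> \<longleftrightarrow> (\<forall>u\<in>pverts G. \<forall>v\<in>pverts G. (u, v) \<in> parcs G \<longrightarrow>
       card {w \<in> pverts G - {u, v}. (u, w) \<notin> parcs G \<and> (v, w) \<notin> parcs G} < c)"
  proof -
    have "{w \<in> pverts (graph_complement G). (u, w) \<in> parcs (graph_complement G) \<and>
            (v, w) \<in> parcs (graph_complement G)} =
          {w \<in> pverts G - {u, v}. (u, w) \<notin> parcs G \<and> (v, w) \<notin> parcs G}"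
      if "u \<in> pverts G" "v \<in> pverts G" for u v
      using that by (auto simp: graph_complement_def)
    moreover have "(u \<noteq> v \<and> (u, v) \<notin> parcs (graph_complement G)) \<longleftrightarrow> (u, v) \<in> parcs G"
      if "u \<in> pverts G" "v \<in> pverts G" for u v
      using that assms by (auto simp: graph_complement_def pair_graph_iff irrefl_def)
    moreover have "pverts (graph_complement G) = pverts G"
      by (simp add: graph_complement_def)
    ultimately show ?thesis
      unfolding c_closed_def by (metis (no_types, lifting))
  qed
  also have "\<dots> \<longleftrightarrow> (\<forall>(u, v) \<in> parcs G.
       card {w \<in> pverts G - {u, v}. (u, w) \<notin> parcs G \<and> (v, w) \<notin> parcs G} < c)"
    using assms by (fastforce simp: pair_graph_iff)
  finally show ?thesis .
qed

lemma card_maximal_degenerate_sets_le: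
  assumes "pair_graph G"
  shows "card (maximal_degenerate_sets d G) \<le> 2 ^ card (pverts G)"
proof -
  have "finite (pverts G)" using assms by (simp add: pair_graph_iff)
  moreover have "maximal_degenerate_sets d G \<subseteq> Pow (pverts G)"
    by (auto simp: maximal_degenerate_sets_def)
  ultimately show ?thesis by (metis card_Pow card_mono finite_Pow_iff)
qed

lemma max_num_degenerate_set:
  fixes d N :: nat
  defines "A \<equiv> {card (maximal_degenerate_sets d H) | H :: nat pair_pre_digraph.
            pair_graph H \<and> card (pverts H) = N}"
  shows "finite A" and "A \<noteq> {}"
proof -
  have "A \<subseteq> {..2 ^ N}" using card_maximal_degenerate_sets_le by (auto simp: A_def)
  then show "finite A" by (rule finite_subset) simp
  have "pair_graph \<lparr> pverts = {..<N}, parcs = {} \<rparr>"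
    by (simp add: pair_graph_iff sym_def irrefl_def)
  then show "A \<noteq> {}" unfolding A_def by fastforce
qed

end

theory Submission
  imports Defs
begin

text \<open>
  Let \<open>S\<close> be a maximal \<open>d\<close>-degenerate set. For an edge \<open>ab\<close>, all but fewer than \<open>c\<close> vertices are
  adjacent to \<open>a\<close> or \<open>b\<close>. If \<open>G[S]\<close> has a matching of \<open>2d\<close> edges, then a vertex of \<open>S\<close> outside the
  common non-neighbourhoods of these edges has \<open>2d\<close> neighbours in the matching; since \<open>G[S]\<close> has at
  most \<open>d|S|\<close> edges there are at most \<open>4d\<close> such vertices. So \<open>S\<close> lies in a set of size \<open>2dc + 8d\<close>
  determined by \<open>8d\<close> vertices, in which it is still maximal.

  Otherwise \<open>S = K \<union> I\<close> with \<open>|K| \<le> 4d\<close> and \<open>I\<close> independent. If more than \<open>d\<close> vertices of \<open>K\<close> have a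
  neighbour in \<open>I\<close>, pick an edge to \<open>I\<close> from each of \<open>d + 1\<close> of them; outside the common
  non-neighbourhoods at most \<open>d\<close> vertices of \<open>I\<close> are left, as \<open>K\<^bsub>d+1,d+1\<^esub>\<close> is not \<open>d\<close>-degenerate, and
  \<open>S\<close> is again confined. If the set \<open>L\<close> of these vertices has size at most \<open>d\<close>, then \<open>I\<close> is a maximal
  independent set among the vertices whose neighbours in \<open>K\<close> all lie in \<open>L\<close>, and such sets are counted
  by deleting one vertex at a time.

  The additive \<open>8d\<close> costs only a constant factor, because the maximum number of maximal
  \<open>d\<close>-degenerate sets on \<open>N + 1\<close> vertices is at most a constant times that on \<open>N\<close> vertices.
\<close>

subsection \<open>Degeneracy in terms of the adjacency relation\<close>

text \<open>The relation \<open>A\<close> stays fixed while the vertex set varies, so passing to an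
  induced subgraph only changes the set argument.\<close>

definition degen_on :: "nat \<Rightarrow> 'a rel \<Rightarrow> 'a set \<Rightarrow> bool" where
  "degen_on d A S \<longleftrightarrow> (\<forall>T \<subseteq> S. T \<noteq> {} \<longrightarrow> (\<exists>v\<in>T. card (T \<inter> A `` {v}) \<le> d))"

text \<open>Testing one-vertex extensions captures inclusion-maximality because degeneracy is
  hereditary.\<close>

definition max_degen :: "nat \<Rightarrow> 'a rel \<Rightarrow> 'a set \<Rightarrow> 'a set set" where
  "max_degen d A V =
     {S. S \<subseteq> V \<and> degen_on d A S \<and> (\<forall>w\<in>V - S. \<not> degen_on d A (insert w S))}"

text \<open>For symmetric irreflexive \<open>A\<close> these are the inclusion-maximal independent
  subsets of \<open>U\<close>, with maximality recast as domination.\<close>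

definition max_indep :: "'a rel \<Rightarrow> 'a set \<Rightarrow> 'a set set" where
  "max_indep A U =
     {I. I \<subseteq> U \<and> (\<forall>x\<in>I. \<forall>y\<in>I. (x, y) \<notin> A) \<and> (\<forall>w\<in>U - I. \<exists>x\<in>I. (w, x) \<in> A)}"

lemma degen_on_subset: "degen_on d A S \<Longrightarrow> T \<subseteq> S \<Longrightarrow> degen_on d A T"
  unfolding degen_on_def by blast

lemma degen_onD:
  assumes "degen_on d A S" "T \<subseteq> S" "T \<noteq> {}"
  obtains v where "v \<in> T" "card (T \<inter> A `` {v}) \<le> d"
  using assms unfolding degen_on_def by blast

lemma max_degen_subset: "max_degen d A V \<subseteq> Pow V"
  by (auto simp: max_degen_def)

lemma max_indep_subset: "max_indep A U \<subseteq> Pow U"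
  by (auto simp: max_indep_def)

lemma finite_max_degen [simp]: "finite V \<Longrightarrow> finite (max_degen d A V)"
  by (rule finite_subset[OF max_degen_subset]) simp

lemma finite_max_indep [simp]: "finite U \<Longrightarrow> finite (max_indep A U)"
  by (rule finite_subset[OF max_indep_subset]) simp

text \<open>Shrinking the ground set leaves fewer extensions to test. This is how a maximal set
  confined to few vertices gets counted in a small graph.\<close>

lemma max_degen_mono:
  "S \<in> max_degen d A V \<Longrightarrow> S \<subseteq> V' \<Longrightarrow> V' \<subseteq> V \<Longrightarrow> S \<in> max_degen d A V'"
  unfolding max_degen_def by blast

lemma degenerate_iff_degen_on:
  assumes "S \<subseteq> pverts G"
  shows "degenerate d (with_proj G \<restriction> S) \<longleftrightarrow> degen_on d (parcs G) S"
proof -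
  have "out_degree ((with_proj G \<restriction> S) \<restriction> T) v = card (T \<inter> parcs G `` {v})"
    if "T \<subseteq> S" "v \<in> T" for T v
  proof -
    have "out_arcs ((with_proj G \<restriction> S) \<restriction> T) v = Pair v ` (T \<inter> parcs G `` {v})"
      using that by (auto simp: out_arcs_def induce_subgraph_def)
    then show ?thesis
      by (simp add: out_degree_def card_image inj_on_def)
  qed
  then show ?thesis
    unfolding degenerate_def degen_on_def by auto
qed

lemma maximal_degenerate_sets_eq:
  "maximal_degenerate_sets d G = max_degen d (parcs G) (pverts G)"
proof -
  have "(\<forall>T \<subseteq> pverts G. S \<subset> T \<longrightarrow> \<not> degenerate d (with_proj G \<restriction> T)) \<longleftrightarrow>
        (\<forall>w\<in>pverts G - S. \<not> degen_on d (parcs G) (insert w S))" (is "?L \<longleftrightarrow> ?R")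
    if "S \<subseteq> pverts G" for S
  proof
    assume L: ?L
    show ?R
    proof
      fix w assume "w \<in> pverts G - S"
      then have "insert w S \<subseteq> pverts G" "S \<subset> insert w S" using that by auto
      then show "\<not> degen_on d (parcs G) (insert w S)"
        using L degenerate_iff_degen_on by blast
    qed
  next
    assume R: ?R
    show ?L
    proof (intro allI impI)
      fix T assume T: "T \<subseteq> pverts G" "S \<subset> T"
      then obtain w where "w \<in> T - S" by blast
      then have "w \<in> pverts G - S" "insert w S \<subseteq> T" using T by auto
      then show "\<not> degenerate d (with_proj G \<restriction> T)"
        using R T(1) degenerate_iff_degen_on degen_on_subset by metis
    qed
  qed
  then show ?thesis
    unfolding maximal_degenerate_sets_def max_degen_def
    by (intro Collect_cong conj_cong refl degenerate_iff_degen_on) auto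
qed

section \<open>Comparison with the maximum over graphs on natural numbers\<close>

lemma card_max_degen_le_nat:
  assumes "finite (V :: nat set)" "card V = N" "B \<subseteq> V \<times> V" "sym B" "irrefl B"
  shows "card (max_degen d B V) \<le> max_num_degenerate d N"
proof -
  let ?H = "\<lparr> pverts = V, parcs = B \<rparr>"
  have "pair_graph ?H" using assms by (simp add: pair_graph_iff)
  then show ?thesis
    unfolding max_num_degenerate_def
    using assms max_num_degenerate_set[of d N] maximal_degenerate_sets_eq[of d ?H]
    by (intro Max_ge) (auto intro!: exI[of _ ?H])
qed

lemma max_num_degenerate_obtain:
  obtains B and V :: "nat set"
  where "finite V" "card V = N" "B \<subseteq> V \<times> V" "sym B" "irrefl B"
    "card (max_degen d B V) = max_num_degenerate d N"
proof -
  have "max_num_degenerate d N \<in> {card (maximal_degenerate_sets d H) | H :: nat pair_pre_digraph.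
            pair_graph H \<and> card (pverts H) = N}"
    unfolding max_num_degenerate_def using max_num_degenerate_set by (intro Max_in)
  then obtain H :: "nat pair_pre_digraph" where H: "pair_graph H" "card (pverts H) = N"
     "card (maximal_degenerate_sets d H) = max_num_degenerate d N" by auto
  show ?thesis
    by (rule that[of "pverts H" "parcs H"])
       (use H in \<open>auto simp: pair_graph_iff maximal_degenerate_sets_eq\<close>)
qed

text \<open>An injection copies the graph into \<open>{..<N}\<close>, and the remaining vertices are
  isolated. Padding the maximal sets keeps them distinct and maximal, which also yields monotonicity
  in \<open>N\<close>.\<close>

lemma card_max_degen_le:
  fixes V :: "'a set"
  assumes "finite V" "card V \<le> N" "sym A" "irrefl A"
  shows "card (max_degen d A V) \<le> max_num_degenerate d N"
proof -
  obtain f where f: "inj_on f V" "f ` V \<subseteq> {..<N}"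
    using assms by (metis card_le_inj card_lessThan finite_lessThan)
  define B where "B = map_prod f f ` (A \<inter> V \<times> V)"
  have B: "(f x, f y) \<in> B \<longleftrightarrow> (x, y) \<in> A" if "x \<in> V" "y \<in> V" for x y
    using that f(1) by (auto simp: B_def inj_on_def)
  have BV: "B \<subseteq> f ` V \<times> f ` V" by (auto simp: B_def)
  have deg: "f ` T \<inter> B `` {f v} = f ` (T \<inter> A `` {v})" if "T \<subseteq> V" "v \<in> V" for T v
    using that B by auto
  have carddeg: "card (f ` T \<inter> B `` {f v}) = card (T \<inter> A `` {v})" if "T \<subseteq> V" "v \<in> V" for T v
    using that f(1) unfolding deg[OF that] by (intro card_image) (auto intro: inj_on_subset)
  \<comment> \<open>vertices outside \<open>f ` V\<close> are isolated in \<open>B\<close>\<close>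
  have degen: "degen_on d B Z \<longleftrightarrow> degen_on d A (V \<inter> f -` Z)" for Z
  proof
    assume Z: "degen_on d B Z"
    show "degen_on d A (V \<inter> f -` Z)"
      unfolding degen_on_def
    proof (intro allI impI)
      fix T assume T: "T \<subseteq> V \<inter> f -` Z" "T \<noteq> {}"
      obtain v where "v \<in> f ` T" "card (f ` T \<inter> B `` {v}) \<le> d"
        using degen_onD[OF Z, of "f ` T"] T by blast
      then show "\<exists>v\<in>T. card (T \<inter> A `` {v}) \<le> d" using carddeg[of T] T by fastforce
    qed
  next
    assume Z: "degen_on d A (V \<inter> f -` Z)"
    show "degen_on d B Z"
      unfolding degen_on_def
    proof (intro allI impI)
      fix T assume T: "T \<subseteq> Z" "T \<noteq> {}"
      show "\<exists>v\<in>T. card (T \<inter> B `` {v}) \<le> d"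
      proof (cases "T \<subseteq> f ` V")
        case True
        define T' where "T' = V \<inter> f -` T"
        have T': "T = f ` T'" "T' \<subseteq> V" using True by (auto simp: T'_def)
        have "T' \<subseteq> V \<inter> f -` Z" using T(1) by (auto simp: T'_def)
        moreover have "T' \<noteq> {}" using T(2) T'(1) by blast
        ultimately obtain v where "v \<in> T'" "card (T' \<inter> A `` {v}) \<le> d"
          using degen_onD[OF Z] by blast
        moreover from this T'(2) have "v \<in> V" by blast
        ultimately have "f v \<in> T" "card (T \<inter> B `` {f v}) \<le> d"
          using carddeg[OF T'(2)] by (simp_all add: T'(1))
        then show ?thesis by blast
      next
        case False
        then obtain v where "v \<in> T" "v \<notin> f ` V" by blast
        then have "T \<inter> B `` {v} = {}" using BV by auto
        then show ?thesis using \<open>v \<in> T\<close> by (metis card.empty zero_le)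
      qed
    qed
  qed
  \<comment> \<open>An isolated vertex can always be added, so the padded set must contain all of
    them to be maximal.\<close>
  define g where "g S = f ` S \<union> ({..<N} - f ` V)" for S
  have vg: "V \<inter> f -` g S = S" if "S \<subseteq> V" for S
    using that f(1) by (auto simp: g_def inj_on_def)
  have "inj_on g (max_degen d A V)"
    by (rule inj_on_inverseI[where g = "\<lambda>Z. V \<inter> f -` Z"])
       (use vg in \<open>auto simp: max_degen_def\<close>)
  moreover have "g S \<in> max_degen d B {..<N}" if S: "S \<in> max_degen d A V" for S
  proof -
    have SV: "S \<subseteq> V" using S by (auto simp: max_degen_def)
    have "\<not> degen_on d B (insert w (g S))" if w: "w \<in> {..<N} - g S" for w
    proof -
      obtain x where x: "x \<in> V" "w = f x" "x \<notin> S" using w by (auto simp: g_def)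
      have "V \<inter> f -` insert w (g S) = insert x S"
        using x vg[OF SV] f(1) by (auto simp: inj_on_def)
      then show ?thesis using degen S x by (simp add: max_degen_def)
    qed
    moreover have "g S \<subseteq> {..<N}" using f SV by (auto simp: g_def)
    ultimately show ?thesis
      using degen[of "g S"] vg[OF SV] S by (auto simp: max_degen_def)
  qed
  ultimately have "card (max_degen d A V) \<le> card (max_degen d B {..<N})"
    by (intro card_inj_on_le) auto
  also have "\<dots> \<le> max_num_degenerate d N"
  proof (rule card_max_degen_le_nat)
    show "B \<subseteq> {..<N} \<times> {..<N}" using BV f(2) by auto
    show "sym B" using assms(3) by (force simp: B_def sym_def)
    show "irrefl B" using assms(4) B BV by (auto simp: irrefl_def)
  qed auto
  finally show ?thesis .
qed

subsection \<open>Growth of the maximum number of maximal degenerate sets\<close>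

lemma degen_on_cong:
  assumes "\<And>x y. x \<in> S \<Longrightarrow> y \<in> S \<Longrightarrow> (x, y) \<in> A \<longleftrightarrow> (x, y) \<in> B"
  shows "degen_on d A S \<longleftrightarrow> degen_on d B S"
proof -
  have "T \<inter> A `` {v} = T \<inter> B `` {v}" if "T \<subseteq> S" "v \<in> T" for T v
    using that assms by auto
  then show ?thesis unfolding degen_on_def by auto
qed

lemma degen_on_Un:
  assumes "degen_on d A X" "degen_on d A Y" "A \<inter> X \<times> Y = {}" "A \<inter> Y \<times> X = {}"
  shows "degen_on d A (X \<union> Y)"
  unfolding degen_on_def
proof (intro allI impI)
  fix T assume T: "T \<subseteq> X \<union> Y" "T \<noteq> {}"
  have *: "\<exists>v\<in>T. card (T \<inter> A `` {v}) \<le> d"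
    if T: "T \<subseteq> X \<union> Y" and ne: "T \<inter> X \<noteq> {}" and dX: "degen_on d A X" and AX: "A \<inter> X \<times> Y = {}" for X Y
  proof -
    obtain v where v: "v \<in> T \<inter> X" "card (T \<inter> X \<inter> A `` {v}) \<le> d"
      using degen_onD[OF dX, of "T \<inter> X"] ne by blast
    have "T \<inter> A `` {v} = T \<inter> X \<inter> A `` {v}" using v T AX by auto
    then show ?thesis using v by (intro bexI[of _ v]) auto
  qed
  show "\<exists>v\<in>T. card (T \<inter> A `` {v}) \<le> d"
    using *[of X Y] *[of Y X] T assms by blast
qed

lemma degen_on_small:
  assumes "finite X" "card X \<le> Suc d" "irrefl A"
  shows "degen_on d A X"
  unfolding degen_on_def
proof (intro allI impI)
  fix T assume T: "T \<subseteq> X" "T \<noteq> {}"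
  then obtain v where v: "v \<in> T" by blast
  have "T \<inter> A `` {v} \<subseteq> X - {v}" using T assms(3) by (auto simp: irrefl_def)
  then have "card (T \<inter> A `` {v}) \<le> card (X - {v})" using assms(1) by (intro card_mono) auto
  also have "\<dots> \<le> d" using v T assms by (simp add: subset_iff)
  finally show "\<exists>v\<in>T. card (T \<inter> A `` {v}) \<le> d" using v by blast
qed

text \<open>A disjoint clique on \<open>d + 2\<close> vertices is not \<open>d\<close>-degenerate
  but becomes so when any vertex is dropped, so every maximal set extends in at least two
  ways.\<close>

lemma max_num_degenerate_add_clique:
  "2 * max_num_degenerate d N \<le> max_num_degenerate d (N + (d + 2))"
proof -
  obtain B and V :: "nat set" where V: "finite V" "card V = N" "B \<subseteq> V \<times> V" "sym B" "irrefl B"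
    "card (max_degen d B V) = max_num_degenerate d N"
    by (rule max_num_degenerate_obtain)
  obtain Q where Q: "finite Q" "card Q = d + 2" "Q \<subseteq> - V"
    using infinite_arbitrarily_large[of "- V" "d + 2"] V(1) by auto
  obtain a where a: "a \<in> Q" using Q(2) by fastforce
  obtain b where b: "b \<in> Q" "b \<noteq> a"
  proof -
    have "card (Q - {a}) = d + 1" using Q a by simp
    then have "Q - {a} \<noteq> {}" by (metis card.empty add_is_0 one_neq_zero)
    then show ?thesis using that by blast
  qed
  define A where "A = B \<union> {(x, y). x \<in> Q \<and> y \<in> Q \<and> x \<noteq> y}"
  have A: "sym A" "irrefl A" using V by (auto simp: A_def sym_def irrefl_def)
  have AB: "degen_on d A S \<longleftrightarrow> degen_on d B S" if "S \<subseteq> V" for S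
    by (rule degen_on_cong) (use that Q in \<open>auto simp: A_def\<close>)
  have nQ: "\<not> degen_on d A Q"
  proof
    assume "degen_on d A Q"
    then obtain v where v: "v \<in> Q" "card (Q \<inter> A `` {v}) \<le> d"
      using degen_onD[of d A Q Q] a by blast
    have "Q \<inter> A `` {v} = Q - {v}" using v V Q by (auto simp: A_def)
    then show False using v Q by simp
  qed
  let ?g = "\<lambda>(S, x). S \<union> (Q - {x})"
  have "?g (S, x) \<in> max_degen d A (V \<union> Q)" if S: "S \<in> max_degen d B V" and x: "x \<in> Q" for S x
  proof -
    have SV: "S \<subseteq> V" using S by (auto simp: max_degen_def)
    have "degen_on d A (S \<union> (Q - {x}))"
    proof (rule degen_on_Un)
      show "degen_on d A S" using S AB[OF SV] by (simp add: max_degen_def)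
      show "degen_on d A (Q - {x})" using Q x A by (intro degen_on_small) auto
    qed (use SV Q V(3) in \<open>auto simp: A_def\<close>)
    moreover have "\<not> degen_on d A (insert w (S \<union> (Q - {x})))"
      if w: "w \<in> V \<union> Q - (S \<union> (Q - {x}))" for w
    proof (cases "w \<in> V")
      case True
      then have "\<not> degen_on d A (insert w S)" using S w AB[of "insert w S"] SV by (auto simp: max_degen_def)
      then show ?thesis by (meson degen_on_subset insert_mono sup_ge1)
    next
      case False
      then have "Q \<subseteq> insert w (S \<union> (Q - {x}))" using w by auto
      then show ?thesis using nQ degen_on_subset by blast
    qed
    ultimately show ?thesis using SV by (auto simp: max_degen_def)
  qed
  then have img: "?g ` (max_degen d B V \<times> {a, b}) \<subseteq> max_degen d A (V \<union> Q)"
    using a b by blast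
  have "inj_on ?g (max_degen d B V \<times> {a, b})"
  \<comment> \<open>Only one clique vertex is missing from the set, so it is \<open>b\<close>
    exactly when \<open>a\<close> is present.\<close>
  proof (rule inj_on_inverseI[where g = "\<lambda>Z. (Z \<inter> V, if a \<in> Z then b else a)"])
    fix p assume "p \<in> max_degen d B V \<times> {a, b}"
    then obtain S x where p: "p = (S, x)" "S \<subseteq> V" "x \<in> {a, b}"
      by (auto simp: max_degen_def)
    then show "(?g p \<inter> V, if a \<in> ?g p then b else a) = p"
      using Q a b by auto
  qed
  then have "card (max_degen d B V \<times> {a, b}) \<le> card (max_degen d A (V \<union> Q))"
    using img V Q by (intro card_inj_on_le) auto
  also have "\<dots> \<le> max_num_degenerate d (N + (d + 2))"
  proof (rule card_max_degen_le)
    have "card (V \<union> Q) = card V + card Q" using V Q by (intro card_Un_disjoint) auto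
    then show "card (V \<union> Q) \<le> N + (d + 2)" using V Q by simp
  qed (use V Q A in auto)
  finally show ?thesis using V(6) b(2) by (simp add: card_cartesian_product)
qed

lemma max_num_degenerate_pos: "max_num_degenerate d N \<ge> 1"
proof -
  have "max_degen d ({} :: nat rel) {..<N} = {{..<N}}"
    by (auto simp: max_degen_def degen_on_def)
  then show ?thesis
    using card_max_degen_le_nat[of "{..<N}" N "{}" d] by (simp add: irrefl_def)
qed

lemma max_num_degenerate_mono:
  assumes "N \<le> M" shows "max_num_degenerate d N \<le> max_num_degenerate d M"
proof -
  obtain B and V :: "nat set" where V: "finite V" "card V = N" "sym B" "irrefl B"
    "card (max_degen d B V) = max_num_degenerate d N"
    using max_num_degenerate_obtain by metis
  then show ?thesis using card_max_degen_le[of V M B d] assms by simp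
qed

text \<open>One disjoint clique is added for each full block of \<open>d + 2\<close> vertices;
  monotonicity covers the remainder.\<close>

lemma max_num_degenerate_exponential: "2 ^ (N div (d + 2)) \<le> max_num_degenerate d N"
proof -
  have "2 ^ k \<le> max_num_degenerate d (k * (d + 2))" for k
  proof (induction k)
    case 0
    then show ?case using max_num_degenerate_pos by simp
  next
    case (Suc k)
    then show ?case
      using max_num_degenerate_add_clique[of d "k * (d + 2)"] by (simp add: algebra_simps)
  qed
  also have "max_num_degenerate d (N div (d + 2) * (d + 2)) \<le> max_num_degenerate d N"
    by (rule max_num_degenerate_mono) (rule div_times_less_eq_dividend)
  finally show ?thesis .
qed

lemma sum_Pow_power_card:
  fixes x :: "'b :: comm_semiring_1"
  assumes "finite V"
  shows "(\<Sum>R\<in>Pow V. x ^ card R) = (1 + x) ^ card V"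
  using prod_add[OF assms, of "\<lambda>_. x" "\<lambda>_. 1"] by (simp add: add.commute)

text \<open>
  Averaging over the vertices bounds the number of sets omitting more than a proportion \<open>1/t\<close> of
  the vertices by \<open>t\<close> times the maximum for one vertex less; the sets omitting fewer vertices are
  outnumbered by the exponential lower bound.
\<close>

lemma max_num_degenerate_Suc_le:
  "\<exists>C\<ge>1. \<forall>N. real (max_num_degenerate d (Suc N)) \<le> C * real (max_num_degenerate d N)"
proof -
  \<comment> \<open>The root is chosen so that \<open>b ^ (2 * Suc N)\<close> is at most four times
    the exponential lower bound for \<open>N\<close> vertices.\<close>
  define b :: real where "b = root (2 * (d + 2)) 2"
  have b1: "b > 1" and bpow: "b ^ (2 * (d + 2)) = 2"
    unfolding b_def by (simp_all del: mult_Suc_right)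
  \<comment> \<open>\<open>m\<close> ensures \<open>1 + 1 / m <= b\<close>, which controls the sum
    over all subsets. Later \<open>t\<close> ensures \<open>m < b ^ t\<close>, which controls the
    weight of a set omitting few vertices.\<close>
  obtain m :: nat where m: "1 / (b - 1) < m" using reals_Archimedean2 by blast
  have m0: "m > 0" using m b1 by (cases "m = 0") (auto simp: divide_less_0_iff)
  have mb: "1 + 1 / real m \<le> b" using m b1 m0 by (simp add: field_simps)
  obtain t where t: "real m < b ^ t" using real_arch_pow[OF b1] by blast
  have "real (max_num_degenerate d (Suc N)) \<le> (t + 4) * real (max_num_degenerate d N)" for N
  proof -
    let ?D = "max_num_degenerate d N"
    obtain B and V :: "nat set" where V: "finite V" "card V = Suc N" "sym B" "irrefl B"
      "card (max_degen d B V) = max_num_degenerate d (Suc N)"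
      using max_num_degenerate_obtain by metis
    let ?F = "max_degen d B V"
    define F1 where "F1 = {S\<in>?F. t * card (V - S) \<le> Suc N}"
    define F2 where "F2 = {S\<in>?F. t * card (V - S) > Suc N}"
    have fin: "finite ?F" "finite F1" "finite F2" using V(1) by (auto simp: F1_def F2_def)
    \<comment> \<open>A maximal set avoiding \<open>v\<close> stays maximal after \<open>v\<close>
      is deleted, and then only \<open>N\<close> vertices are left.\<close>
    have "card {S\<in>?F. v \<notin> S} \<le> ?D" if "v \<in> V" for v
    proof -
      have "{S\<in>?F. v \<notin> S} \<subseteq> max_degen d B (V - {v})"
        using max_degen_subset[of d B V] by (auto intro: max_degen_mono)
      then have "card {S\<in>?F. v \<notin> S} \<le> card (max_degen d B (V - {v}))"
        using V(1) by (intro card_mono) auto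
      also have "\<dots> \<le> ?D" using V that by (intro card_max_degen_le) auto
      finally show ?thesis .
    qed
    then have "(\<Sum>v\<in>V. card {S\<in>?F. v \<notin> S}) \<le> Suc N * ?D"
      using sum_bounded_above[of V "\<lambda>v. card {S\<in>?F. v \<notin> S}" ?D] V(2) by simp
    \<comment> \<open>Double counting of the pairs \<open>(v, S)\<close> with \<open>v\<close>
      omitted by \<open>S\<close>.\<close>
    moreover have "(\<Sum>v\<in>V. card {S\<in>?F. v \<notin> S}) = (\<Sum>S\<in>?F. card {v\<in>V. v \<notin> S})"
      using sum_multicount_gen[of V ?F "\<lambda>v S. v \<notin> S"] V(1) by (simp add: fin)
    moreover have "{v\<in>V. v \<notin> S} = V - S" for S by auto
    ultimately have tot: "(\<Sum>S\<in>?F. card (V - S)) \<le> Suc N * ?D" by simp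
    have "card F2 * Suc N \<le> (\<Sum>S\<in>F2. t * card (V - S))"
      using sum_bounded_below[of F2 "Suc N" "\<lambda>S. t * card (V - S)"] by (auto simp: F2_def)
    also have "\<dots> \<le> (\<Sum>S\<in>?F. t * card (V - S))"
      using fin by (intro sum_mono2) (auto simp: F2_def)
    also have "\<dots> \<le> t * (Suc N * ?D)" unfolding sum_distrib_left[symmetric] using tot by simp
    finally have "card F2 * Suc N \<le> (t * ?D) * Suc N" by (simp only: mult_ac)
    then have F2: "card F2 \<le> t * ?D" using mult_le_cancel2 by blast
    have "real (card F1) = (\<Sum>S\<in>F1. 1)" by simp
    \<comment> \<open>Each weight is at least 1, since few omitted vertices mean
      \<open>m ^ card (V - S) <= b ^ Suc N\<close>. The weighted sum over all possible complements
      then has a closed form.\<close>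
    also have "\<dots> \<le> (\<Sum>S\<in>F1. b ^ Suc N * (1 / m) ^ card (V - S))"
    proof (rule sum_mono)
      fix S assume "S \<in> F1"
      then have le: "t * card (V - S) \<le> Suc N" by (simp add: F1_def)
      have "real m ^ card (V - S) \<le> (b ^ t) ^ card (V - S)" using t by (intro power_mono) auto
      also have "\<dots> \<le> b ^ Suc N"
        unfolding power_mult[symmetric] using le b1 by (intro power_increasing) auto
      finally show "1 \<le> b ^ Suc N * (1 / m) ^ card (V - S)"
        using m0 by (simp add: power_one_over field_simps)
    qed
    also have "\<dots> = (\<Sum>R\<in>(-) V ` F1. b ^ Suc N * (1 / m) ^ card R)"
      by (subst sum.reindex)
         (auto simp: F1_def max_degen_def intro!: inj_on_inverseI[where g = "(-) V"])
    also have "\<dots> \<le> (\<Sum>R\<in>Pow V. b ^ Suc N * (1 / m) ^ card R)"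
      using V(1) b1 by (intro sum_mono2) auto
    also have "\<dots> = b ^ Suc N * (1 + 1 / m) ^ Suc N"
      using sum_Pow_power_card[OF V(1), of "1 / real m"] V(2) by (simp add: sum_distrib_left[symmetric])
    also have "\<dots> \<le> b ^ Suc N * b ^ Suc N"
      using mb b1 by (intro mult_left_mono power_mono) auto
    also have "\<dots> = b ^ (2 * Suc N)" by (metis mult_2 power_add)
    also have "\<dots> \<le> b ^ (2 * (d + 2) * (N div (d + 2) + 2))"
    proof (rule power_increasing)
      have "N = (N div (d + 2)) * (d + 2) + N mod (d + 2)"
        by (rule div_mult_mod_eq[symmetric])
      moreover have "N mod (d + 2) < d + 2" by simp
      ultimately have "N < (N div (d + 2)) * (d + 2) + (d + 2)" by linarith
      then show "2 * Suc N \<le> 2 * (d + 2) * (N div (d + 2) + 2)" by (simp add: algebra_simps)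
    qed (use b1 in simp)
    also have "\<dots> = 2 ^ (N div (d + 2) + 2)" using bpow by (metis power_mult)
    also have "\<dots> = 4 * real (2 ^ (N div (d + 2)))" by simp
    also have "\<dots> \<le> 4 * real ?D"
      by (intro mult_left_mono of_nat_mono max_num_degenerate_exponential) simp
    finally have F1: "real (card F1) \<le> 4 * real ?D" .
    have "?F = F1 \<union> F2" by (auto simp: F1_def F2_def)
    then have "real (card ?F) \<le> real (card F1) + real (card F2)"
      using card_Un_le[of F1 F2] by (metis of_nat_add of_nat_le_iff)
    also have "real (card F2) \<le> t * real ?D" using F2 by (metis of_nat_le_iff of_nat_mult)
    finally show ?thesis using F1 V(5) by (simp add: algebra_simps)
  qed
  then show ?thesis by (intro exI[of _ "real t + 4"]) auto
qed

text \<open>Iterating the one-vertex bound gives a factor independent of \<open>N\<close>; with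
  \<open>k = 8 * d\<close> it absorbs the additive term in the size bound.\<close>

lemma max_num_degenerate_add_le:
  "\<exists>C\<ge>1. \<forall>N. real (max_num_degenerate d (N + k)) \<le> C * real (max_num_degenerate d N)"
proof -
  obtain C where C: "C \<ge> 1"
    "\<And>N. real (max_num_degenerate d (Suc N)) \<le> C * real (max_num_degenerate d N)"
    using max_num_degenerate_Suc_le by metis
  have "real (max_num_degenerate d (N + k)) \<le> C ^ k * real (max_num_degenerate d N)" for N
  proof (induction k)
    case (Suc k)
    have "real (max_num_degenerate d (N + Suc k)) \<le> C * real (max_num_degenerate d (N + k))"
      using C(2)[of "N + k"] by simp
    also have "\<dots> \<le> C * (C ^ k * real (max_num_degenerate d N))"
      using Suc C(1) by (intro mult_left_mono) auto
    finally show ?case by simp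
  qed simp
  then show ?thesis using C(1) by (intro exI[of _ "C ^ k"]) auto
qed

subsection \<open>Maximal independent sets\<close>

text \<open>Joining a clique on \<open>d\<close> vertices turns independent sets into \<open>d\<close>-degenerate ones.\<close>

lemma card_max_indep_le_max_num_degenerate:
  fixes W :: "'a set"
  assumes "finite W" "sym A" "irrefl A"
  shows "card (max_indep A W) \<le> max_num_degenerate d (card W + d)"
proof -
  define Q :: "('a + nat) set" where "Q = Inr ` {..<d}"
  \<comment> \<open>\<open>Inr\<close> supplies fresh vertices adjacent to all others;
    \<open>d\<close> of them form \<open>Q\<close>.\<close>
  define J :: "('a + nat) rel" where
    "J = map_prod Inl Inl ` A \<union> {(u, v). u \<noteq> v \<and> (u \<in> range Inr \<or> v \<in> range Inr)}"
  have Q: "finite Q" "card Q = d" by (auto simp: Q_def card_image)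
  have J: "sym J" "irrefl J" using assms(2,3) by (auto simp: J_def sym_def irrefl_def)
  have JL: "(Inl x, Inl y) \<in> J \<longleftrightarrow> (x, y) \<in> A" for x y by (auto simp: J_def)
  let ?g = "\<lambda>I. Inl ` I \<union> Q"
  have "?g I \<in> max_degen d J (?g W)" if I: "I \<in> max_indep A W" for I
  proof -
    have IW: "I \<subseteq> W" using I by (auto simp: max_indep_def)
    have "degen_on d J (?g I)"
      unfolding degen_on_def
    proof (intro allI impI)
      fix T assume T: "T \<subseteq> ?g I" "T \<noteq> {}"
      \<comment> \<open>A vertex of the independent part has its neighbours from \<open>T\<close> in
        \<open>Q\<close>; without such a vertex \<open>T\<close> itself lies in
        \<open>Q\<close>.\<close>
      have "\<exists>v\<in>T. T \<inter> J `` {v} \<subseteq> Q"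
      proof (cases "\<exists>x. Inl x \<in> T")
        case True
        then obtain x where x: "Inl x \<in> T" by blast
        then have "x \<in> I" using T(1) by (auto simp: Q_def)
        then have "(Inl x, Inl y) \<notin> J" if "y \<in> I" for y
          using I that by (simp add: JL max_indep_def)
        then have "T \<inter> J `` {Inl x} \<subseteq> Q" using T(1) by blast
        then show ?thesis using x by blast
      next
        case False
        then have "T \<subseteq> Q" using T(1) by auto
        then show ?thesis using T(2) by blast
      qed
      then show "\<exists>v\<in>T. card (T \<inter> J `` {v}) \<le> d" using Q by (metis card_mono)
    qed
    moreover have "\<not> degen_on d J (insert w (?g I))" if w: "w \<in> ?g W - ?g I" for w
    proof
      assume deg: "degen_on d J (insert w (?g I))"
      obtain y where y: "w = Inl y" "y \<in> W - I" using w by auto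
      obtain x where x: "x \<in> I" "(y, x) \<in> A"
        using I y(2) unfolding max_indep_def by blast
      \<comment> \<open>Two adjacent vertices of \<open>W\<close> together with \<open>Q\<close>
        form a clique on \<open>d + 2\<close> vertices.\<close>
      let ?T = "insert (Inl y) (insert (Inl x) Q)"
      have "x \<noteq> y" using x assms(3) by (auto simp: irrefl_def)
      then have cT: "card ?T = d + 2" using Q by (auto simp: Q_def card_insert_if)
      have "?T \<subseteq> insert w (?g I)" using x y by auto
      then obtain v where v: "v \<in> ?T" "card (?T \<inter> J `` {v}) \<le> d"
        using degen_onD[OF deg, of ?T] by blast
      have "(x, y) \<in> A" using x assms(2) by (auto simp: sym_def)
      then have "?T - {v} \<subseteq> ?T \<inter> J `` {v}"
        using v(1) x(2) by (auto simp: Q_def JL) (auto simp: J_def)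
      then have "card (?T - {v}) \<le> card (?T \<inter> J `` {v})" using Q by (intro card_mono) auto
      then show False using v cT Q(1) by (simp add: card_Diff_singleton)
    qed
    ultimately show ?thesis using IW by (auto simp: max_degen_def)
  qed
  moreover have "inj_on ?g (max_indep A W)"
    by (rule inj_on_inverseI[where g = "\<lambda>Z. Inl -` Z"]) (auto simp: Q_def)
  ultimately have "card (max_indep A W) \<le> card (max_degen d J (?g W))"
    using assms(1) Q by (intro card_inj_on_le) auto
  also have "\<dots> \<le> max_num_degenerate d (card W + d)"
  proof (rule card_max_degen_le)
    have "card (?g W) \<le> card (Inl ` W :: ('a + nat) set) + card Q" by (rule card_Un_le)
    then show "card (?g W) \<le> card W + d" using Q by (simp add: card_image)
  qed (use assms Q J in auto)
  finally show ?thesis .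
qed

text \<open>
  Delete a vertex \<open>v\<close>. Either \<open>S - {v}\<close> remains maximal, or some neighbour \<open>u\<close> of \<open>v\<close> could replace
  \<open>v\<close>, and then \<open>S - {v}\<close> is a maximal independent set of common non-neighbours of \<open>u\<close> and \<open>v\<close>.
\<close>

lemma card_max_indep_le:
  assumes "finite U" "sym A"
    and "\<And>a b W. (a, b) \<in> A \<Longrightarrow> W \<subseteq> U - {a, b} \<Longrightarrow>
           \<forall>w\<in>W. (a, w) \<notin> A \<and> (b, w) \<notin> A \<Longrightarrow> card (max_indep A W) \<le> B"
  shows "card (max_indep A U) \<le> 1 + (card U)\<^sup>2 * B"
  using assms(1,3)
proof (induction U)
  case empty
  have "max_indep A {} = {{}}" by (auto simp: max_indep_def)
  then show ?case by simp
next
  case (insert v U)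
  let ?F = "max_indep A (insert v U)"
  define F1 where "F1 = {S\<in>?F. S - {v} \<in> max_indep A U}"
  define W where "W u = {w\<in>U - {u, v}. (u, w) \<notin> A \<and> (v, w) \<notin> A}" for u
  have symA: "(x, y) \<in> A \<Longrightarrow> (y, x) \<in> A" for x y using assms(2) by (auto simp: sym_def)
  have "inj_on (\<lambda>S. S - {v}) F1"
  proof (rule inj_onI)
    fix S T assume ST: "S \<in> F1" "T \<in> F1" "S - {v} = T - {v}"
    \<comment> \<open>If just one of the sets contained \<open>v\<close>, maximality of the other
      would give \<open>v\<close> a neighbour lying in both, against independence of the
      first.\<close>
    have "v \<in> S \<longleftrightarrow> v \<in> T"
    proof (rule ccontr)
      assume "\<not> ?thesis"
      then obtain X Y where XY: "X \<in> ?F" "Y \<in> ?F" "v \<in> X" "v \<notin> Y" "X - {v} = Y"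
        using ST unfolding F1_def by (metis (mono_tags, lifting) Diff_empty Diff_insert0 mem_Collect_eq)
      have "v \<in> insert v U - Y" using XY(4) by blast
      then obtain x where x: "x \<in> Y" "(v, x) \<in> A"
        using XY(2) unfolding max_indep_def by blast
      then have "x \<in> X" using XY(5) by blast
      then show False using x XY(1,3) unfolding max_indep_def by blast
    qed
    then show "S = T" using ST(3) by blast
  qed
  then have F1: "card F1 \<le> card (max_indep A U)"
    using insert.hyps by (intro card_inj_on_le[of "\<lambda>S. S - {v}"]) (auto simp: F1_def)
  have "?F - F1 \<subseteq> (\<Union>u\<in>{u\<in>U. (u, v) \<in> A}. insert v ` max_indep A (W u))"
  proof
    fix S assume S: "S \<in> ?F - F1"
    then have SU: "S \<subseteq> insert v U" and ind: "\<And>x y. x \<in> S \<Longrightarrow> y \<in> S \<Longrightarrow> (x, y) \<notin> A"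
      and max: "\<And>w. w \<in> insert v U \<Longrightarrow> w \<notin> S \<Longrightarrow> \<exists>x\<in>S. (w, x) \<in> A"
      and nmax: "S - {v} \<notin> max_indep A U"
      by (auto simp: max_indep_def F1_def)
    \<comment> \<open>\<open>u\<close> witnesses that \<open>S - {v}\<close> is not maximal in
      \<open>U\<close>. As \<open>S\<close> is maximal, the neighbour of \<open>u\<close> in
      \<open>S\<close> must be \<open>v\<close>.\<close>
    obtain u where u: "u \<in> U" "u \<notin> S - {v}" "\<forall>x\<in>S - {v}. (u, x) \<notin> A"
      using nmax SU ind by (auto simp: max_indep_def)
    have "u \<noteq> v" using u insert.hyps by auto
    then obtain x where "x \<in> S" "(u, x) \<in> A" using max[of u] u by auto
    then have v: "v \<in> S" "(u, v) \<in> A" using u by auto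
    have "S - {v} \<in> max_indep A (W u)"
      unfolding max_indep_def
    proof (intro CollectI conjI ballI)
      show "S - {v} \<subseteq> W u" using SU u ind v by (auto simp: W_def)
      fix w assume w: "w \<in> W u - (S - {v})"
      then have "w \<in> insert v U" "w \<notin> S" by (auto simp: W_def)
      then obtain x where "x \<in> S" "(w, x) \<in> A" using max by blast
      moreover have "x \<noteq> v" using w symA \<open>(w, x) \<in> A\<close> by (auto simp: W_def)
      ultimately show "\<exists>x\<in>S - {v}. (w, x) \<in> A" by blast
    qed (use ind in auto)
    moreover have "S = insert v (S - {v})" using v by auto
    ultimately show "S \<in> (\<Union>u\<in>{u\<in>U. (u, v) \<in> A}. insert v ` max_indep A (W u))"
      using u(1) v(2) by blast
  qed
  then have "card (?F - F1) \<le> card (\<Union>u\<in>{u\<in>U. (u, v) \<in> A}. insert v ` max_indep A (W u))"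
    using insert.hyps by (intro card_mono) (auto simp: W_def)
  also have "\<dots> \<le> (\<Sum>u\<in>{u\<in>U. (u, v) \<in> A}. card (insert v ` max_indep A (W u)))"
    using insert.hyps by (intro card_UN_le) auto
  also have "\<dots> \<le> (\<Sum>u\<in>{u\<in>U. (u, v) \<in> A}. B)"
  proof (rule sum_mono)
    fix u assume u: "u \<in> {u\<in>U. (u, v) \<in> A}"
    have "card (insert v ` max_indep A (W u)) \<le> card (max_indep A (W u))"
      using insert.hyps by (intro card_image_le finite_max_indep) (auto simp: W_def)
    also have "\<dots> \<le> B" by (rule insert.prems[of u v]) (use u in \<open>auto simp: W_def\<close>)
    finally show "card (insert v ` max_indep A (W u)) \<le> B" .
  qed
  also have "\<dots> \<le> card U * B"
    using insert.hyps by (auto intro!: mult_right_mono card_mono)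
  finally have F2: "card (?F - F1) \<le> card U * B" .
  have IH: "card (max_indep A U) \<le> 1 + (card U)\<^sup>2 * B"
    by (rule insert.IH) (rule insert.prems, auto)
  have "card ?F = card F1 + card (?F - F1)"
    using insert.hyps by (subst card_Un_disjoint[symmetric]) (auto simp: F1_def intro!: arg_cong[of _ _ card])
  also have "\<dots> \<le> 1 + ((card U)\<^sup>2 + card U) * B" using F1 F2 IH by (simp add: algebra_simps)
  also have "\<dots> \<le> 1 + (card (insert v U))\<^sup>2 * B"
    using insert.hyps by (simp add: power2_eq_square algebra_simps)
  finally show ?case .
qed

subsection \<open>The structure of maximal degenerate sets\<close>

text \<open>The sum counts the edges between \<open>P\<close> and \<open>X\<close>. Removing
  vertices of degree at most \<open>d\<close> one at a time destroys at most \<open>d\<close> of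
  them per removal.\<close>

lemma degen_on_sum_degree_le:
  assumes "degen_on d A S" "finite S" "sym A" "P \<union> X \<subseteq> S" "P \<inter> X = {}"
  shows "(\<Sum>x\<in>X. card (P \<inter> A `` {x})) \<le> d * (card P + card X)"
  using assms(4,5)
proof (induction "card P + card X" arbitrary: P X rule: less_induct)
  case less
  have fin: "finite P" "finite X" using less.prems assms(2) by (auto intro: finite_subset)
  show ?case
  proof (cases "P \<union> X = {}")
    case True
    then show ?thesis by simp
  next
    case False
    then obtain v where v: "v \<in> P \<union> X" "card ((P \<union> X) \<inter> A `` {v}) \<le> d"
      using degen_onD[OF assms(1) less.prems(1)] by blast
    show ?thesis
    proof (cases "v \<in> X")
      case True
      then have c: "card X = Suc (card (X - {v}))" using fin by (metis card_Suc_Diff1)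
      have "(\<Sum>x\<in>X - {v}. card (P \<inter> A `` {x})) \<le> d * (card P + card (X - {v}))"
        using less.hyps[of P "X - {v}"] less.prems c by auto
      moreover have "card (P \<inter> A `` {v}) \<le> d"
        using v(2) fin by (meson card_mono finite_Int finite_UnI inf_mono le_trans order_refl sup_ge1)
      moreover have "(\<Sum>x\<in>X. card (P \<inter> A `` {x})) =
          card (P \<inter> A `` {v}) + (\<Sum>x\<in>X - {v}. card (P \<inter> A `` {x}))"
        using True fin by (intro sum.remove)
      ultimately show ?thesis unfolding c by (simp only: add_Suc_right mult_Suc_right)
    next
      case False
      then have vP: "v \<in> P" using v by auto
      then have c: "card P = Suc (card (P - {v}))" using fin by (metis card_Suc_Diff1)
      \<comment> \<open>Deleting \<open>v\<close> costs each of its neighbours one unit; by symmetry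
        the total loss over \<open>X\<close> is the degree of \<open>v\<close> into
        \<open>X\<close>.\<close>
      have "card (P \<inter> A `` {x}) = card ((P - {v}) \<inter> A `` {x}) + (if (v, x) \<in> A then 1 else 0)" for x
      proof (cases "(v, x) \<in> A")
        case True
        then have "(x, v) \<in> A" using assms(3) by (auto simp: sym_def)
        then have "P \<inter> A `` {x} = insert v ((P - {v}) \<inter> A `` {x})" using vP by auto
        then show ?thesis using True fin by simp
      next
        case False
        then have "(x, v) \<notin> A" using assms(3) by (auto simp: sym_def)
        then have "P \<inter> A `` {x} = (P - {v}) \<inter> A `` {x}" by auto
        then show ?thesis using False by simp
      qed
      then have "(\<Sum>x\<in>X. card (P \<inter> A `` {x})) =
          (\<Sum>x\<in>X. card ((P - {v}) \<inter> A `` {x})) + card (X \<inter> A `` {v})"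
        using fin by (simp add: sum.distrib sum.If_cases) (simp add: Image_singleton Collect_conj_eq)
      moreover have "(\<Sum>x\<in>X. card ((P - {v}) \<inter> A `` {x})) \<le> d * (card (P - {v}) + card X)"
        using less.hyps[of "P - {v}" X] less.prems c by auto
      moreover have "card (X \<inter> A `` {v}) \<le> d"
        using v(2) fin by (meson card_mono finite_Int finite_UnI inf_mono le_trans order_refl sup_ge2)
      ultimately show ?thesis unfolding c by (simp only: add_Suc mult_Suc_right)
    qed
  qed
qed

text \<open>In a subset containing \<open>w\<close>, the vertex \<open>w\<close> itself has low
  degree. The lemma serves to contradict maximality.\<close>

lemma degen_on_insert:
  assumes "degen_on d A S" "finite S" "irrefl A" "card (S \<inter> A `` {w}) \<le> d"
  shows "degen_on d A (insert w S)"
  unfolding degen_on_def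
proof (intro allI impI)
  fix T assume T: "T \<subseteq> insert w S" "T \<noteq> {}"
  show "\<exists>v\<in>T. card (T \<inter> A `` {v}) \<le> d"
  proof (cases "w \<in> T")
    case True
    have "T \<inter> A `` {w} \<subseteq> S \<inter> A `` {w}" using T assms(3) by (auto simp: irrefl_def)
    then have "card (T \<inter> A `` {w}) \<le> card (S \<inter> A `` {w})" using assms(2) by (intro card_mono) auto
    then show ?thesis using True assms(4) by (intro bexI[of _ w]) auto
  next
    case False
    then have "T \<subseteq> S" using T by auto
    then show ?thesis using assms(1) T(2) unfolding degen_on_def by blast
  qed
qed

text \<open>\<open>E\<close> is a matching; all that matters is the lower bound on degrees into its vertex set.\<close>

lemma matching_or_vertex_cover:
  assumes "finite S"
  shows "(\<exists>E. E \<subseteq> A \<inter> S \<times> S \<and> card E \<le> k \<and> card (Field E) \<le> 2 * k \<and>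
            (\<forall>x. (\<forall>(a, b)\<in>E. (x, a) \<in> A \<or> (x, b) \<in> A) \<longrightarrow> k \<le> card (Field E \<inter> A `` {x}))) \<or>
         (\<exists>K\<subseteq>S. card K \<le> 2 * k \<and> (\<forall>x\<in>S - K. \<forall>y\<in>S - K. (x, y) \<notin> A))"
proof (induction k)
  case 0
  then show ?case by (intro disjI1 exI[of _ "{}"]) auto
next
  case (Suc k)
  then show ?case
  proof (elim disjE exE conjE)
    fix E assume E: "E \<subseteq> A \<inter> S \<times> S" "card E \<le> k" "card (Field E) \<le> 2 * k"
      "\<forall>x. (\<forall>(a, b)\<in>E. (x, a) \<in> A \<or> (x, b) \<in> A) \<longrightarrow> k \<le> card (Field E \<inter> A `` {x})"
    have FS: "Field E \<subseteq> S" using E(1) by (auto simp: Field_def)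
    have finF: "finite (Field E)" using FS assms by (rule finite_subset)
    have finE: "finite E" using E(1) assms by (meson finite_Int finite_SigmaI finite_subset)
    show ?case
    proof (cases "\<forall>x\<in>S - Field E. \<forall>y\<in>S - Field E. (x, y) \<notin> A")
      case True
      then show ?thesis using FS E(3) by (intro disjI2 exI[of _ "Field E"]) auto
    next
      case False
      then obtain p q where pq: "p \<in> S - Field E" "q \<in> S - Field E" "(p, q) \<in> A" by blast
      let ?E = "insert (p, q) E"
      have F: "Field ?E = insert p (insert q (Field E))" by (auto simp: Field_def)
      have "Suc k \<le> card (Field ?E \<inter> A `` {x})"
        if x: "\<forall>(a, b)\<in>?E. (x, a) \<in> A \<or> (x, b) \<in> A" for x
      proof -
        \<comment> \<open>One endpoint of the new edge is a neighbour of \<open>x\<close>, and it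
          lies outside \<open>Field E\<close>, so the count grows by one.\<close>
        obtain r where r: "r \<in> {p, q}" "(x, r) \<in> A" using x by auto
        have "Suc k \<le> Suc (card (Field E \<inter> A `` {x}))" using E(4) x by auto
        also have "\<dots> = card (insert r (Field E \<inter> A `` {x}))" using r pq finF by auto
        also have "\<dots> \<le> card (Field ?E \<inter> A `` {x})"
          using r finF unfolding F by (intro card_mono) auto
        finally show ?thesis .
      qed
      moreover have "card (Field ?E) \<le> 2 * Suc k"
        using E(3) finF unfolding F by (simp add: card_insert_if)
      moreover have "card ?E \<le> Suc k" using E(2) finE by (simp add: card_insert_if)
      moreover have "?E \<subseteq> A \<inter> S \<times> S" using E(1) pq by auto
      ultimately show ?thesis by (intro disjI1 exI[of _ ?E]) blast
    qed
  next
    fix K assume "K \<subseteq> S" "card K \<le> 2 * k" "\<forall>x\<in>S - K. \<forall>y\<in>S - K. (x, y) \<notin> A"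
    then show ?case by (intro disjI2 exI[of _ K]) auto
  qed
qed

text \<open>In the complement of a \<open>c\<close>-closed graph each edge contributes fewer than
  \<open>c\<close> vertices. A vertex of \<open>V\<close> outside the union is, for every edge of
  \<open>E\<close>, an endpoint or adjacent to an endpoint.\<close>

definition edge_nonneighbours :: "'a rel \<Rightarrow> 'a set \<Rightarrow> 'a rel \<Rightarrow> 'a set" where
  "edge_nonneighbours A V E = (\<Union>(a, b)\<in>E. {w\<in>V - {a, b}. (a, w) \<notin> A \<and> (b, w) \<notin> A})"

lemma card_edge_nonneighbours_le:
  assumes "finite E" "E \<subseteq> A"
    and "\<And>a b. (a, b) \<in> A \<Longrightarrow> card {w\<in>V - {a, b}. (a, w) \<notin> A \<and> (b, w) \<notin> A} < c"
  shows "card (edge_nonneighbours A V E) \<le> card E * c"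
proof -
  have "card (edge_nonneighbours A V E) \<le>
      (\<Sum>e\<in>E. card (case e of (a, b) \<Rightarrow> {w\<in>V - {a, b}. (a, w) \<notin> A \<and> (b, w) \<notin> A}))"
    unfolding edge_nonneighbours_def by (rule card_UN_le[OF assms(1)])
  also have "\<dots> \<le> card E * c"
    using sum_bounded_above[of E "\<lambda>e. card (case e of (a, b) \<Rightarrow> {w\<in>V - {a, b}. (a, w) \<notin> A \<and> (b, w) \<notin> A})" c]
      assms(2,3) by (fastforce intro: less_imp_le)
  finally show ?thesis .
qed

text \<open>Both alternatives encode \<open>S\<close> by few vertices: \<open>(P, E)\<close>
  confines it to a small set, while \<open>(K, L)\<close> fixes the ground set in which the rest of
  \<open>S\<close> is a maximal independent set.\<close>

lemma max_degen_structure: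
  assumes V: "finite V" "sym A" "irrefl A" and d: "d \<ge> 1" and S: "S \<in> max_degen d A V"
  shows "(\<exists>P E. P \<subseteq> V \<and> card P \<le> 8 * d \<and> E \<subseteq> A \<inter> P \<times> P \<and> card E \<le> 2 * d \<and>
            S \<subseteq> P \<union> edge_nonneighbours A V E) \<or>
         (\<exists>K L I. K \<subseteq> V \<and> card K \<le> 4 * d \<and> L \<subseteq> K \<and> S = K \<union> I \<and>
            I \<in> max_indep A {w\<in>V - K. K \<inter> A `` {w} \<subseteq> L})"
proof -
  have SV: "S \<subseteq> V" and dS: "degen_on d A S"
    and max: "\<And>w. w \<in> V - S \<Longrightarrow> \<not> degen_on d A (insert w S)"
    using S by (auto simp: max_degen_def)
  have fS: "finite S" using SV V(1) by (rule finite_subset)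
  have symA: "(x, y) \<in> A \<Longrightarrow> (y, x) \<in> A" for x y using V(2) by (auto simp: sym_def)
  consider (matching) E where "E \<subseteq> A \<inter> S \<times> S" "card E \<le> 2 * d" "card (Field E) \<le> 2 * (2 * d)"
      "\<And>x. (\<forall>(a, b)\<in>E. (x, a) \<in> A \<or> (x, b) \<in> A) \<Longrightarrow> 2 * d \<le> card (Field E \<inter> A `` {x})"
    | (cover) K where "K \<subseteq> S" "card K \<le> 2 * (2 * d)" "\<forall>x\<in>S - K. \<forall>y\<in>S - K. (x, y) \<notin> A"
    using matching_or_vertex_cover[OF fS, where k = "2 * d" and A = A] by blast
  then show ?thesis
  proof cases
    case matching
    define X where "X = S - Field E - edge_nonneighbours A V E"
    have FS: "Field E \<subseteq> S" using matching(1) by (auto simp: Field_def)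
    have "2 * d \<le> card (Field E \<inter> A `` {x})" if x: "x \<in> X" for x
    proof (rule matching(4), clarify)
      fix a b assume ab: "(a, b) \<in> E" "(x, b) \<notin> A"
      have "a \<in> Field E" "b \<in> Field E" using ab by (auto simp: Field_def)
      then have "x \<in> V - {a, b}" using x SV by (auto simp: X_def)
      then show "(x, a) \<in> A"
        using x ab symA by (auto simp: X_def edge_nonneighbours_def)
    qed
    then have "card X * (2 * d) \<le> (\<Sum>x\<in>X. card (Field E \<inter> A `` {x}))"
      using sum_bounded_below[of X "2 * d" "\<lambda>x. card (Field E \<inter> A `` {x})"] by simp
    also have "\<dots> \<le> d * (card (Field E) + card X)"
      by (rule degen_on_sum_degree_le[OF dS fS V(2)]) (use FS in \<open>auto simp: X_def\<close>)
    also have "\<dots> \<le> d * (4 * d + card X)" using matching(3) by (intro mult_left_mono) auto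
    \<comment> \<open>This forces \<open>card X <= 4 * d\<close>; the other \<open>4 * d\<close>
      vertices allowed in \<open>P\<close> are those of \<open>Field E\<close>.\<close>
    finally have "d * (2 * card X) \<le> d * (4 * d + card X)" by (simp add: mult_ac)
    then have "2 * card X \<le> 4 * d + card X" using d by simp
    then have "card (Field E \<union> X) \<le> 8 * d"
      using card_Un_le[of "Field E" X] matching(3) by linarith
    moreover have "E \<subseteq> A \<inter> (Field E \<union> X) \<times> (Field E \<union> X)"
      using matching(1) by (auto simp: Field_def)
    moreover have "S \<subseteq> (Field E \<union> X) \<union> edge_nonneighbours A V E" by (auto simp: X_def)
    moreover have "Field E \<union> X \<subseteq> V" using FS SV by (auto simp: X_def)
    ultimately show ?thesis using matching(2) by blast
  next
    case cover
    define I where "I = S - K"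
    define L where "L = {x\<in>K. \<exists>w\<in>I. (x, w) \<in> A}"
    have indI: "(x, y) \<notin> A" if "x \<in> I" "y \<in> I" for x y using cover(3) that by (auto simp: I_def)
    have fK: "finite K" using cover(1) fS by (rule finite_subset)
    show ?thesis
    proof (cases "card L \<le> d")
      case True
      have "I \<in> max_indep A {w\<in>V - K. K \<inter> A `` {w} \<subseteq> L}"
        unfolding max_indep_def
      proof (intro CollectI conjI ballI)
        show "I \<subseteq> {w\<in>V - K. K \<inter> A `` {w} \<subseteq> L}" using SV symA by (auto simp: I_def L_def)
        fix w assume w: "w \<in> {w\<in>V - K. K \<inter> A `` {w} \<subseteq> L} - I"
        show "\<exists>x\<in>I. (w, x) \<in> A"
        proof (rule ccontr)
          assume "\<not> ?thesis"
          \<comment> \<open>Without a neighbour in \<open>I\<close>, all neighbours of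
            \<open>w\<close> in \<open>S\<close> lie in \<open>L\<close>. They number at most
            \<open>d\<close>, so \<open>w\<close> could be added to \<open>S\<close>.\<close>
          then have "S \<inter> A `` {w} \<subseteq> L" using w by (auto simp: I_def)
          moreover have "finite L" using fK by (simp add: L_def)
          ultimately have "card (S \<inter> A `` {w}) \<le> d" using True by (meson card_mono le_trans)
          then have "degen_on d A (insert w S)" using dS fS V(3) by (intro degen_on_insert)
          then show False using max[of w] w by (auto simp: I_def)
        qed
      qed (use indI in auto)
      moreover have "S = K \<union> I" using cover(1) by (auto simp: I_def)
      moreover have "L \<subseteq> K" by (auto simp: L_def)
      moreover have "K \<subseteq> V" "card K \<le> 4 * d" using cover SV by auto
      ultimately show ?thesis by blast
    next
      case False
      then obtain L' where L': "L' \<subseteq> L" "card L' = Suc d" "finite L'"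
        using obtain_subset_with_card_n[of "Suc d" L] by auto
      have "\<forall>x\<in>L'. \<exists>w. w \<in> I \<and> (x, w) \<in> A" using L'(1) by (auto simp: L_def)
      then obtain h where h: "\<And>x. x \<in> L' \<Longrightarrow> h x \<in> I \<and> (x, h x) \<in> A" by metis
      have L'K: "L' \<subseteq> K" using L'(1) by (auto simp: L_def)
      \<comment> \<open>\<open>h\<close> may repeat values, but the \<open>d + 1\<close> first
        endpoints are distinct.\<close>
      define E where "E = (\<lambda>x. (x, h x)) ` L'"
      define X where "X = I - h ` L' - edge_nonneighbours A V E"
      \<comment> \<open>\<open>y\<close> is adjacent to \<open>x\<close> or to \<open>h x\<close>,
        and independence of \<open>I\<close> excludes the latter. Hence \<open>L'\<close> and
        \<open>X\<close> are completely joined.\<close>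
      have X: "(x, y) \<in> A" if "x \<in> L'" "y \<in> X" for x y
      proof (rule ccontr)
        assume "(x, y) \<notin> A"
        moreover have "(h x, y) \<notin> A" using indI h[OF that(1)] that(2) by (auto simp: X_def)
        moreover have "y \<in> V - {x, h x}" using that L'K SV by (auto simp: X_def I_def)
        ultimately show False using that by (auto simp: X_def E_def edge_nonneighbours_def)
      qed
      have finX: "finite X" using fS by (auto simp: X_def I_def)
      have cX: "card X \<le> d"
      proof (rule ccontr)
        \<comment> \<open>Otherwise both sides have more than \<open>d\<close> vertices and every
          degree in \<open>L' \<union> X\<close> exceeds \<open>d\<close>.\<close>
        assume nX: "\<not> card X \<le> d"
        have "L' \<union> X \<subseteq> S" "L' \<union> X \<noteq> {}" using L'K cover(1) L'(2) by (auto simp: X_def I_def)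
        then obtain v where v: "v \<in> L' \<union> X" "card ((L' \<union> X) \<inter> A `` {v}) \<le> d"
          using degen_onD[OF dS] by blast
        have "X \<subseteq> (L' \<union> X) \<inter> A `` {v} \<or> L' \<subseteq> (L' \<union> X) \<inter> A `` {v}"
          using v(1) X symA by blast
        then have "card X \<le> card ((L' \<union> X) \<inter> A `` {v}) \<or> card L' \<le> card ((L' \<union> X) \<inter> A `` {v})"
          using L'(3) finX by (auto intro!: card_mono)
        then show False using nX L'(2) v(2) by auto
      qed
      define P where "P = K \<union> h ` L' \<union> X"
      have "card P \<le> card K + card (h ` L') + card X"
        unfolding P_def by (meson card_Un_le le_trans add_le_mono1)
      moreover have "card (h ` L') \<le> Suc d" using card_image_le[OF L'(3), of h] L'(2) by simp
      \<comment> \<open>\<open>4 * d + (d + 1) + d <= 8 * d\<close> because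
        \<open>d >= 1\<close>.\<close>
      ultimately have "card P \<le> 8 * d" using cX cover(2) d by linarith
      moreover have "P \<subseteq> V" using h cover(1) SV by (auto simp: P_def X_def I_def)
      moreover have "E \<subseteq> A \<inter> P \<times> P" using h L'K by (auto simp: E_def P_def)
      moreover have "card E \<le> 2 * d" using card_image_le[OF L'(3), of "\<lambda>x. (x, h x)"] L'(2) d by (simp add: E_def)
      moreover have "S \<subseteq> P \<union> edge_nonneighbours A V E" by (auto simp: P_def X_def I_def)
      ultimately show ?thesis by blast
    qed
  qed
qed

section \<open>Counting the encodings of maximal sets\<close>

lemma card_subsets_card_le:
  assumes "finite V" "card V \<ge> 1"
  shows "card {P. P \<subseteq> V \<and> card P \<le> k} \<le> Suc k * card V ^ k"
proof -
  have "{P. P \<subseteq> V \<and> card P \<le> k} = (\<Union>i\<in>{..k}. {P. P \<subseteq> V \<and> card P = i})" by auto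
  then have "card {P. P \<subseteq> V \<and> card P \<le> k} \<le> (\<Sum>i\<in>{..k}. card {P. P \<subseteq> V \<and> card P = i})"
    by (simp add: card_UN_le)
  also have "\<dots> \<le> (\<Sum>i\<in>{..k}. card V ^ k)"
  proof (rule sum_mono)
    fix i assume i: "i \<in> {..k}"
    have "card {P. P \<subseteq> V \<and> card P = i} = card V choose i" by (rule n_subsets[OF assms(1)])
    also have "\<dots> \<le> card V ^ i"
      by (cases "i \<le> card V") (auto simp: binomial_le_pow binomial_eq_0)
    also have "\<dots> \<le> card V ^ k" using i assms(2) by (intro power_increasing) auto
    finally show "card {P. P \<subseteq> V \<and> card P = i} \<le> card V ^ k" .
  qed
  finally show ?thesis by simp
qed

lemma card_UN_le_mult:
  assumes "finite I" "card I \<le> m" "\<And>i. i \<in> I \<Longrightarrow> card (F i) \<le> B"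
  shows "card (\<Union>i\<in>I. F i) \<le> m * B"
proof -
  have "card (\<Union>i\<in>I. F i) \<le> (\<Sum>i\<in>I. card (F i))" by (rule card_UN_le[OF assms(1)])
  also have "\<dots> \<le> card I * B" using sum_bounded_above[of I "\<lambda>i. card (F i)" B] assms(3) by simp
  also have "\<dots> \<le> m * B" using assms(2) by simp
  finally show ?thesis .
qed

text \<open>Choosing \<open>P\<close> gives the exponent \<open>8 * d\<close>, while
  \<open>E\<close> and \<open>L\<close> cost only factors depending on \<open>d\<close>. Choosing
  \<open>K\<close> gives exponent \<open>4 * d\<close>, and the maximal independent sets add
  2.\<close>

lemma card_max_degen_bound:
  assumes V: "finite V" "card V \<ge> 1" "sym A" "irrefl A" and d: "d \<ge> 1"
    and c: "\<And>a b. (a, b) \<in> A \<Longrightarrow> card {w\<in>V - {a, b}. (a, w) \<notin> A \<and> (b, w) \<notin> A} < c"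
  shows "card (max_degen d A V) \<le>
    (Suc (8 * d) * 2 ^ (8 * d)\<^sup>2 + 2 * (Suc (4 * d) * 2 ^ (4 * d))) * card V ^ (8 * d) *
      max_num_degenerate d (2 * d * c + 8 * d)"
proof -
  let ?D = "max_num_degenerate d (2 * d * c + 8 * d)"
  let ?n = "card V"
  let ?Ps = "{P. P \<subseteq> V \<and> card P \<le> 8 * d}"
  let ?Ks = "{K. K \<subseteq> V \<and> card K \<le> 4 * d}"
  let ?Es = "\<lambda>P. {E. E \<subseteq> A \<inter> P \<times> P \<and> card E \<le> 2 * d}"
  let ?G1 = "\<Union>P\<in>?Ps. \<Union>E\<in>?Es P. max_degen d A (P \<union> edge_nonneighbours A V E)"
  let ?G2 = "\<Union>K\<in>?Ks. \<Union>L\<in>Pow K. (\<union>) K ` max_indep A {w\<in>V - K. K \<inter> A `` {w} \<subseteq> L}"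
  have finP: "finite P" if "P \<in> ?Ps" for P
    using that V(1) by (blast intro: finite_subset)
  have finK: "finite K" if "K \<in> ?Ks" for K
    using that V(1) by (blast intro: finite_subset)
  have finEn: "finite (edge_nonneighbours A V E)" for E
    by (rule finite_subset[OF _ V(1)]) (auto simp: edge_nonneighbours_def)
  have "S \<in> ?G1 \<union> ?G2" if S: "S \<in> max_degen d A V" for S
    using max_degen_structure[OF V(1,3,4) d S]
  proof (elim disjE exE conjE)
    fix P E assume PE: "P \<subseteq> V" "card P \<le> 8 * d" "E \<subseteq> A \<inter> P \<times> P" "card E \<le> 2 * d"
      "S \<subseteq> P \<union> edge_nonneighbours A V E"
    have "P \<union> edge_nonneighbours A V E \<subseteq> V" using PE(1) by (auto simp: edge_nonneighbours_def)
    then have "S \<in> max_degen d A (P \<union> edge_nonneighbours A V E)"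
      by (rule max_degen_mono[OF S PE(5)])
    then show ?thesis using PE by (intro UnI1 UN_I[of P] UN_I[of E]) simp_all
  next
    fix K L I assume "K \<subseteq> V" "card K \<le> 4 * d" "L \<subseteq> K" "S = K \<union> I"
      "I \<in> max_indep A {w\<in>V - K. K \<inter> A `` {w} \<subseteq> L}"
    then show ?thesis by (intro UnI2 UN_I[of K] UN_I[of L]) simp_all
  qed
  then have sub: "max_degen d A V \<subseteq> ?G1 \<union> ?G2" by (rule subsetI)
  have finEs: "finite (?Es P)" "card (?Es P) \<le> 2 ^ (8 * d)\<^sup>2" if P: "P \<in> ?Ps" for P
  proof -
    have sub: "?Es P \<subseteq> Pow (P \<times> P)" by auto
    have "finite (Pow (P \<times> P))" using finP[OF P] by simp
    then show "finite (?Es P)" using sub by (rule rev_finite_subset)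
    have "card (?Es P) \<le> card (Pow (P \<times> P))"
      using sub \<open>finite (Pow (P \<times> P))\<close> by (intro card_mono)
    also have "\<dots> = 2 ^ (card P * card P)" using finP[OF P] by (simp add: card_Pow card_cartesian_product)
    also have "\<dots> \<le> 2 ^ (8 * d)\<^sup>2"
      unfolding power2_eq_square using P by (intro power_increasing mult_le_mono) auto
    finally show "card (?Es P) \<le> 2 ^ (8 * d)\<^sup>2" .
  qed
  have g1: "card (max_degen d A (P \<union> edge_nonneighbours A V E)) \<le> ?D"
    if P: "P \<in> ?Ps" and E: "E \<in> ?Es P" for P E
  proof (rule card_max_degen_le)
    have "finite E"
      by (rule finite_subset[of E "P \<times> P"]) (use E finP[OF P] in auto)
    then have "card (edge_nonneighbours A V E) \<le> card E * c"
      using E c by (intro card_edge_nonneighbours_le) auto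
    also have "\<dots> \<le> 2 * d * c" using E by simp
    finally show "card (P \<union> edge_nonneighbours A V E) \<le> 2 * d * c + 8 * d"
      using P card_Un_le[of P "edge_nonneighbours A V E"] by auto
  qed (use V finP[OF P] finEn in auto)
  have "card ?G1 \<le> (Suc (8 * d) * ?n ^ (8 * d)) * (2 ^ (8 * d)\<^sup>2 * ?D)"
  proof (rule card_UN_le_mult)
    show "card ?Ps \<le> Suc (8 * d) * ?n ^ (8 * d)" using card_subsets_card_le[OF V(1,2)] .
    show "card (\<Union>E\<in>?Es P. max_degen d A (P \<union> edge_nonneighbours A V E)) \<le> 2 ^ (8 * d)\<^sup>2 * ?D"
      if "P \<in> ?Ps" for P
      by (rule card_UN_le_mult) (use finEs[OF that] g1[OF that] in auto)
  qed (use V(1) in auto)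
  moreover have "card ?G2 \<le> (Suc (4 * d) * ?n ^ (4 * d)) * (2 ^ (4 * d) * (1 + ?n\<^sup>2 * ?D))"
  proof (rule card_UN_le_mult)
    show "card ?Ks \<le> Suc (4 * d) * ?n ^ (4 * d)" using card_subsets_card_le[OF V(1,2)] .
    fix K assume K: "K \<in> ?Ks"
    show "card (\<Union>L\<in>Pow K. (\<union>) K ` max_indep A {w\<in>V - K. K \<inter> A `` {w} \<subseteq> L})
        \<le> 2 ^ (4 * d) * (1 + ?n\<^sup>2 * ?D)"
    proof (rule card_UN_le_mult)
      show "finite (Pow K)" using finK[OF K] by simp
      show "card (Pow K) \<le> 2 ^ (4 * d)" using finK[OF K] K by (simp add: card_Pow)
      fix L
      let ?U = "{w\<in>V - K. K \<inter> A `` {w} \<subseteq> L}"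
      have U: "finite ?U" "?U \<subseteq> V" using V(1) by auto
      have "card ((\<union>) K ` max_indep A ?U) \<le> card (max_indep A ?U)"
        using U by (intro card_image_le) simp
      also have "\<dots> \<le> 1 + (card ?U)\<^sup>2 * ?D"
      \<comment> \<open>\<open>W\<close> consists of common non-neighbours of an edge, so it has
        fewer than \<open>c\<close> vertices and leaves room for the \<open>d\<close> clique
        vertices.\<close>
      proof (rule card_max_indep_le)
        fix a b W assume ab: "(a, b) \<in> A" and W: "W \<subseteq> ?U - {a, b}" "\<forall>w\<in>W. (a, w) \<notin> A \<and> (b, w) \<notin> A"
        have finW: "finite W" using W(1) U(1) by (meson finite_Diff finite_subset)
        have "W \<subseteq> {w\<in>V - {a, b}. (a, w) \<notin> A \<and> (b, w) \<notin> A}" using W by blast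
        then have "card W \<le> card {w\<in>V - {a, b}. (a, w) \<notin> A \<and> (b, w) \<notin> A}"
          using V(1) by (intro card_mono) auto
        then have "card W \<le> c" using c[OF ab] by simp
        moreover have "c \<le> 2 * d * c" using d by simp
        ultimately have "card W + d \<le> 2 * d * c + 8 * d" by linarith
        then show "card (max_indep A W) \<le> ?D"
          using card_max_indep_le_max_num_degenerate[OF finW V(3,4), of d] max_num_degenerate_mono
          by (meson le_trans)
      qed (use U V in auto)
      also have "\<dots> \<le> 1 + ?n\<^sup>2 * ?D"
        using U V(1) by (intro add_left_mono mult_right_mono power_mono card_mono) auto
      finally show "card ((\<union>) K ` max_indep A ?U) \<le> 1 + ?n\<^sup>2 * ?D" .
    qed
  qed (use V(1) in auto)
  then have "card ?G2 \<le> (Suc (4 * d) * 2 ^ (4 * d)) * (?n ^ (4 * d) * (1 + ?n\<^sup>2 * ?D))"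
    by (simp only: mult_ac)
  \<comment> \<open>Doubling absorbs the summand 1, and \<open>4 * d + 2 <= 8 * d\<close> because
    \<open>d >= 1\<close>.\<close>
  moreover have "?n ^ (4 * d) * (1 + ?n\<^sup>2 * ?D) \<le> 2 * (?n ^ (8 * d) * ?D)"
  proof -
    have "1 \<le> ?n\<^sup>2 * ?D" using V(2) max_num_degenerate_pos[of d] by (simp add: Suc_le_eq)
    then have "?n ^ (4 * d) * (1 + ?n\<^sup>2 * ?D) \<le> ?n ^ (4 * d) * (2 * (?n\<^sup>2 * ?D))"
      by (intro mult_left_mono) auto
    also have "\<dots> = 2 * (?n ^ (4 * d + 2) * ?D)" by (simp only: power_add mult_ac)
    also have "\<dots> \<le> 2 * (?n ^ (8 * d) * ?D)"
      using V(2) d by (intro mult_left_mono mult_right_mono power_increasing) auto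
    finally show ?thesis .
  qed
  then have "(Suc (4 * d) * 2 ^ (4 * d)) * (?n ^ (4 * d) * (1 + ?n\<^sup>2 * ?D)) \<le>
      (Suc (4 * d) * 2 ^ (4 * d)) * (2 * (?n ^ (8 * d) * ?D))"
    by (rule mult_le_mono2)
  moreover have "card (max_degen d A V) \<le> card ?G1 + card ?G2"
  proof -
    have "finite ?G1" using V(1) by (intro finite_UN_I finite_max_degen finite_UnI finEs finP finEn) auto
    moreover have "finite ?G2"
    proof (intro finite_UN_I finite_imageI finite_max_indep)
      show "finite (Pow K)" if "K \<in> ?Ks" for K using finK[OF that] by simp
    qed (use V(1) in simp_all)
    ultimately have "card (max_degen d A V) \<le> card (?G1 \<union> ?G2)" using sub by (intro card_mono) auto
    also have "\<dots> \<le> card ?G1 + card ?G2" by (rule card_Un_le)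
    finally show ?thesis .
  qed
  ultimately have "card (max_degen d A V) \<le>
     (Suc (8 * d) * ?n ^ (8 * d)) * (2 ^ (8 * d)\<^sup>2 * ?D) +
     (Suc (4 * d) * 2 ^ (4 * d)) * (2 * (?n ^ (8 * d) * ?D))" by linarith
  also have "\<dots> = (Suc (8 * d) * 2 ^ (8 * d)\<^sup>2 + 2 * (Suc (4 * d) * 2 ^ (4 * d))) * ?n ^ (8 * d) * ?D"
    by (simp only: distrib_left distrib_right mult_ac)
  finally show ?thesis .
qed

text \<open>\<open>C\<close> is chosen before \<open>c\<close>, \<open>n\<close> and
  \<open>G\<close>, so the constant in the O-notation is uniform in all three.\<close>

theorem theorem22:
  fixes d :: nat
  assumes "d \<ge> 1"
  shows "\<exists>C :: real. \<forall>(c :: nat) (n :: nat) (G :: 'a pair_pre_digraph).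
           pair_graph G \<and> card (pverts G) = n \<and> n \<ge> 1 \<and>
           (\<exists>H. pair_graph H \<and> c_closed c H \<and> G = graph_complement H) \<longrightarrow>
           real (card (maximal_degenerate_sets d G))
             \<le> C * real n ^ (8 * d) * real (max_num_degenerate d (2 * d * c))"
proof -
  \<comment> \<open>\<open>C0\<close> pays for lowering the number of vertices from
    \<open>2 * d * c + 8 * d\<close> to \<open>2 * d * c\<close>.\<close>
  obtain C0 where C0: "C0 \<ge> 1"
    "\<And>N. real (max_num_degenerate d (N + 8 * d)) \<le> C0 * real (max_num_degenerate d N)"
    using max_num_degenerate_add_le by metis
  define M where "M = Suc (8 * d) * 2 ^ (8 * d)\<^sup>2 + 2 * (Suc (4 * d) * 2 ^ (4 * d))"
  have "real (card (maximal_degenerate_sets d G))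
      \<le> (real M * C0) * real n ^ (8 * d) * real (max_num_degenerate d (2 * d * c))"
    if G: "pair_graph G" "card (pverts G) = n" "n \<ge> 1"
      "\<exists>H. pair_graph H \<and> c_closed c H \<and> G = graph_complement H"
    for c n and G :: "'a pair_pre_digraph"
  proof -
    have "card (max_degen d (parcs G) (pverts G)) \<le>
        M * card (pverts G) ^ (8 * d) * max_num_degenerate d (2 * d * c + 8 * d)"
      unfolding M_def
    proof (rule card_max_degen_bound)
      fix a b assume "(a, b) \<in> parcs G"
      then show "card {w\<in>pverts G - {a, b}. (a, w) \<notin> parcs G \<and> (b, w) \<notin> parcs G} < c"
        using G(4) complement_c_closed_iff[OF G(1), of c] by blast
    qed (use G assms in \<open>auto simp: pair_graph_iff\<close>)
    then have "real (card (maximal_degenerate_sets d G)) \<le>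
        real (M * n ^ (8 * d) * max_num_degenerate d (2 * d * c + 8 * d))"
      unfolding maximal_degenerate_sets_eq G(2) by (rule of_nat_mono)
    also have "\<dots> = (real M * real n ^ (8 * d)) * real (max_num_degenerate d (2 * d * c + 8 * d))"
      by simp
    also have "\<dots> \<le> (real M * real n ^ (8 * d)) * (C0 * real (max_num_degenerate d (2 * d * c)))"
      by (intro mult_left_mono C0) simp
    finally show ?thesis by (simp only: mult_ac)
  qed
  then show ?thesis by blast
qed

end
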